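(* Let $A\in S^{n\times n}$ be not positive semidefinite, $a,x_0,b_1,\ldots,b_m\in\mathbb{R}^n$, $\alpha>0$ and $\beta_1,\ldots,\beta_m\in\mathbb{R}$. Consider the problem $$(P)\quad \min_{x\in\mathbb{R}^n}\ x^TAx+a^Tx\quad\mbox{s.t.}\quad \|x-x_0\|^2\le\alpha,\ \ b_i^Tx\le\beta_i,\ i=1,\ldots,m.$$ Suppose that there exists $\overline{x}\in\mathbb{R}^n$ with $\|\overline{x}-x_0\|^2<\alpha$ and $b_i^T\overline{x}<\beta_i$, $i=1,\ldots,m$, and that ${\rm dim}\,{\rm Ker}(A-\lambda_{\min}(A)I_n)\ge s+1$, where $s={\rm dim}\,{\rm span}\{b_1,\ldots,b_m\}$. Let $x^*$ be a feasible point of $(P)$. Then $x^*$ is a global minimizer of $(P)$ if and only if there exists $(\lambda_0,\lambda_1,\ldots,\lambda_m)\in\mathbb{R}^{m+1}_+$ such that all of the following hold: $$2Ax^*+a+2\lambda_0(x^*-x_0)+\sum_{i=1}^m\lambda_ib_i=0,$$ $$\lambda_0(\|x^*-x_0\|^2-\alpha)=0\ \mbox{ and }\ \lambda_i(b_i^Tx^*-\beta_i)=0,\ i=1,\ldots,m,$$ $$A+\lambda_0I_n\succeq 0.$$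
   Context: $S^{n\times n}$ is the space of real symmetric $n\times n$ matrices, $\lambda_{\min}(A)$ is the smallest eigenvalue of $A$, ${\rm Ker}(M)=\{d: Md=0\}$, $\|\cdot\|$ is the Euclidean norm, $\mathbb{R}^{m+1}_+$ is the nonnegative orthant, and $B\succeq 0$ means that $B$ is positive semidefinite. *)

theory Defs
  imports "HOL-Analysis.Analysis"
begin

definition pos_semidef :: "real^'n^'n \<Rightarrow> bool" where
  "pos_semidef B \<longleftrightarrow> transpose B = B \<and> (\<forall>d. d \<bullet> (B *v d) \<ge> 0)"

definition eigenvalues :: "real^'n^'n \<Rightarrow> real set" where
  "eigenvalues A = {\<mu>. \<exists>v. v \<noteq> 0 \<and> A *v v = \<mu> *\<^sub>R v}"

text \<open>For symmetric matrices the set of real eigenvalues is finite and nonempty, so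
  \<open>Min\<close> is meaningful; \<open>lambda_min\<close> is only intended for such matrices.\<close>

definition lambda_min :: "real^'n^'n \<Rightarrow> real" where
  "lambda_min A = Min (eigenvalues A)"

definition Ker :: "real^'n^'n \<Rightarrow> (real^'n) set" where
  "Ker M = {d. M *v d = 0}"

definition objective :: "real^'n^'n \<Rightarrow> real^'n \<Rightarrow> real^'n \<Rightarrow> real" where
  "objective A a x = x \<bullet> (A *v x) + a \<bullet> x"

definition feasible ::
  "nat \<Rightarrow> real^'n \<Rightarrow> real \<Rightarrow> (nat \<Rightarrow> real^'n) \<Rightarrow> (nat \<Rightarrow> real) \<Rightarrow> real^'n \<Rightarrow> bool" where
  "feasible m x0 \<alpha> b \<beta> x \<longleftrightarrow>
     (norm (x - x0))\<^sup>2 \<le> \<alpha> \<and> (\<forall>i\<in>{1..m}. b i \<bullet> x \<le> \<beta> i)"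

end

theory Submission
  imports Defs
begin

text \<open>With \<open>\<mu> = lambda_min A < 0\<close>, the function \<open>g x = f x - \<mu> * (\<parallel>x - x0\<parallel>\<^sup>2 - \<alpha>)\<close> is a convex
  minorant of the objective \<open>f\<close> on the feasible set which agrees with \<open>f\<close> on the sphere. The
  dimension condition yields an eigenvector for \<open>\<mu>\<close> orthogonal to all \<open>b i\<close>. Along its line \<open>g\<close> is
  affine and the linear constraints are constant, so every feasible point can be moved to a feasible
  point of the sphere without increasing \<open>g\<close>. Hence a global minimizer of \<open>f\<close> lies on the sphere and
  minimizes \<open>g\<close>, and the multipliers of \<open>g\<close> at that point, with \<open>-\<mu>\<close> added to the multiplier of the
  ball constraint, are the required ones. Conversely, under the multiplier conditions the Lagrangian
  is a convex quadratic with a critical point at \<open>xstar\<close>.\<close>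

section \<open>Expansions of quadratic functions along a line\<close>

lemma matrix_shift_mult_vec:
  fixes A :: "real^'n^'n"
  shows "(A - \<mu> *\<^sub>R mat 1) *v d = A *v d - \<mu> *\<^sub>R d"
    and "(A + \<mu> *\<^sub>R mat 1) *v d = A *v d + \<mu> *\<^sub>R d"
  by (simp_all add: matrix_vector_mult_diff_rdistrib matrix_vector_mult_add_rdistrib
      scaleR_matrix_vector_assoc [symmetric])

lemma symmetric_inner_commute:
  fixes A :: "real^'n^'n"
  assumes "transpose A = A"
  shows "x \<bullet> (A *v y) = y \<bullet> (A *v x)"
  by (metis assms dot_lmul_matrix inner_commute transpose_matrix_vector)

lemma quadratic_form_add_scaleR:
  fixes A :: "real^'n^'n"
  assumes "transpose A = A"
  shows "(x + t *\<^sub>R e) \<bullet> (A *v (x + t *\<^sub>R e)) =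
    x \<bullet> (A *v x) + 2 * t * (e \<bullet> (A *v x)) + t\<^sup>2 * (e \<bullet> (A *v e))"
  using symmetric_inner_commute [OF assms, of x e]
  by (simp add: matrix_vector_right_distrib matrix_vector_mult_scaleR inner_add_left
      inner_add_right power2_eq_square algebra_simps)

lemma norm_add_scaleR_power2:
  fixes x e :: "'a::real_inner"
  shows "(norm (x + t *\<^sub>R e - z))\<^sup>2 =
    (norm (x - z))\<^sup>2 + 2 * t * ((x - z) \<bullet> e) + t\<^sup>2 * (norm e)\<^sup>2"
  unfolding power2_norm_eq_inner
  by (simp add: inner_diff_left inner_diff_right inner_add_left inner_add_right
      inner_commute power2_eq_square algebra_simps)

lemma objective_add_scaleR:
  fixes A :: "real^'n^'n"
  assumes "transpose A = A"
  shows "objective A a (x + t *\<^sub>R e) =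
    objective A a x + t * ((2 *\<^sub>R (A *v x) + a) \<bullet> e) + t\<^sup>2 * (e \<bullet> (A *v e))"
  unfolding objective_def quadratic_form_add_scaleR [OF assms]
  by (simp add: inner_add_left inner_add_right inner_commute algebra_simps)

text \<open>Dividing by \<open>t\<close> and letting \<open>t\<close> tend to 0 from the right
  removes the quadratic term. This is how first-order conditions are extracted below from
  inequalities that hold only for small positive steps.\<close>

lemma linear_term_nonneg:
  fixes p q \<delta> :: real
  assumes "\<delta> > 0" and "\<And>t. 0 < t \<Longrightarrow> t < \<delta> \<Longrightarrow> t * p + t\<^sup>2 * q \<ge> 0"
  shows "p \<ge> 0"
proof -
  have "eventually (\<lambda>t. p + t * q \<ge> 0) (at_right 0)"
    unfolding eventually_at_right_field
  proof (intro exI conjI allI impI)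
    fix t assume t: "0 < t" "t < \<delta>"
    have "t * (p + t * q) \<ge> 0"
      using assms(2) [OF t] by (simp add: power2_eq_square algebra_simps)
    then show "p + t * q \<ge> 0" using t(1) by (simp add: zero_le_mult_iff)
  qed (use assms in auto)
  moreover have "((\<lambda>t. p + t * q) \<longlongrightarrow> p + 0 * q) (at_right 0)"
    by (intro tendsto_intros)
  ultimately show ?thesis
    using tendsto_lowerbound [of "\<lambda>t. p + t * q" "p + 0 * q" "at_right 0" 0] by simp
qed

section \<open>The smallest eigenvalue\<close>

text \<open>By symmetry, eigenvectors for distinct eigenvalues are orthogonal, and a pairwise
  orthogonal set in finite dimension is finite. Finiteness is what makes \<open>Min\<close> in
  \<open>lambda_min\<close> a lower bound of the eigenvalues.\<close>

lemma finite_eigenvalues: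
  fixes A :: "real^'n^'n"
  assumes "transpose A = A"
  shows "finite (eigenvalues A)"
proof -
  define w where "w \<mu> = (SOME v. v \<noteq> 0 \<and> A *v v = \<mu> *\<^sub>R v)" for \<mu>
  have w: "w \<mu> \<noteq> 0 \<and> A *v w \<mu> = \<mu> *\<^sub>R w \<mu>" if "\<mu> \<in> eigenvalues A" for \<mu>
    using that someI_ex [of "\<lambda>v. v \<noteq> 0 \<and> A *v v = \<mu> *\<^sub>R v"]
    unfolding eigenvalues_def w_def by blast
  have orth: "w \<mu> \<bullet> w \<nu> = 0" if "\<mu> \<in> eigenvalues A" "\<nu> \<in> eigenvalues A" "\<mu> \<noteq> \<nu>" for \<mu> \<nu>
    using symmetric_inner_commute [OF assms, of "w \<mu>" "w \<nu>"] w [OF that(1)] w [OF that(2)] that(3)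
    by (auto simp: inner_commute)
  have "pairwise orthogonal (w ` eigenvalues A)"
    unfolding pairwise_def orthogonal_def using orth by blast
  then have "finite (w ` eigenvalues A)" by (rule pairwise_orthogonal_imp_finite)
  \<comment> \<open>Equal values of \<open>w\<close> at distinct eigenvalues would be a nonzero
    vector orthogonal to itself.\<close>
  moreover have "inj_on w (eigenvalues A)"
    unfolding inj_on_def using orth w by (metis inner_eq_zero_iff)
  ultimately show ?thesis by (rule finite_imageD)
qed

text \<open>The quadratic form attains its minimum on the compact unit sphere. Homogeneity turns
  this minimum into the bound for all vectors, and first-order optimality makes the minimizer an
  eigenvector.\<close>

lemma rayleigh_minimizer:
  fixes A :: "real^'n^'n"
  assumes "transpose A = A"
  obtains \<rho> where "\<rho> \<in> eigenvalues A" and "\<And>d. d \<bullet> (A *v d) \<ge> \<rho> * (norm d)\<^sup>2"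
proof -
  have "continuous_on (sphere 0 1) (\<lambda>d. d \<bullet> (A *v d))"
    by (intro continuous_intros linear_continuous_on linear_linear [THEN iffD2]
        matrix_vector_mul_linear)
  moreover have "sphere (0 :: real^'n) 1 \<noteq> {}" by simp
  ultimately obtain v where v: "norm v = 1"
    and min: "\<And>d. norm d = 1 \<Longrightarrow> v \<bullet> (A *v v) \<le> d \<bullet> (A *v d)"
    using continuous_attains_inf [OF compact_sphere, of "0 :: real^'n" 1 "\<lambda>d. d \<bullet> (A *v d)"]
    by (auto simp: sphere_def)
  define \<rho> where "\<rho> = v \<bullet> (A *v v)"
  have bound: "d \<bullet> (A *v d) \<ge> \<rho> * (norm d)\<^sup>2" for d
  proof (cases "d = 0")
    case False
    have "\<rho> \<le> (inverse (norm d) *\<^sub>R d) \<bullet> (A *v (inverse (norm d) *\<^sub>R d))"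
      unfolding \<rho>_def using False by (intro min) simp
    also have "\<dots> = (d \<bullet> (A *v d)) / (norm d)\<^sup>2"
      by (simp add: matrix_vector_mult_scaleR power2_eq_square divide_inverse)
    finally show ?thesis using False by (simp add: field_simps)
  qed simp
  have "A *v v = \<rho> *\<^sub>R v"
  proof -
    \<comment> \<open>Up to a factor 2, \<open>e\<close> is the negative gradient at
      \<open>v\<close> of the nonnegative function
      \<open>d \<bullet> (A *v d) - \<rho> * (norm d)\<^sup>2\<close>, which vanishes at
      \<open>v\<close>. The linear term in this direction is a negative multiple of
      \<open>e \<bullet> e\<close>, so \<open>e\<close> must be 0.\<close>
    define e where "e = \<rho> *\<^sub>R v - A *v v"
    have "t * (2 * (e \<bullet> (A *v v - \<rho> *\<^sub>R v))) + t\<^sup>2 * (e \<bullet> (A *v e) - \<rho> * (norm e)\<^sup>2) \<ge> 0" for t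
    proof -
      have "(norm (v + t *\<^sub>R e))\<^sup>2 = 1 + 2 * t * (e \<bullet> v) + t\<^sup>2 * (norm e)\<^sup>2"
        using norm_add_scaleR_power2 [of v t e 0] v by (simp add: inner_commute)
      then have "\<rho> * (1 + 2 * t * (e \<bullet> v) + t\<^sup>2 * (norm e)\<^sup>2)
          \<le> \<rho> + 2 * t * (e \<bullet> (A *v v)) + t\<^sup>2 * (e \<bullet> (A *v e))"
        using bound [of "v + t *\<^sub>R e"]
        unfolding quadratic_form_add_scaleR [OF assms] \<rho>_def by simp
      then show ?thesis by (simp add: inner_diff_right algebra_simps)
    qed
    then have "2 * (e \<bullet> (A *v v - \<rho> *\<^sub>R v)) \<ge> 0"
      by (rule linear_term_nonneg [OF zero_less_one])
    moreover have "A *v v - \<rho> *\<^sub>R v = - e" by (simp add: e_def)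
    ultimately have "e \<bullet> e \<le> 0" by simp
    then have "e = 0" by (metis inner_eq_zero_iff inner_ge_zero order_antisym)
    then show ?thesis by (simp add: e_def)
  qed
  with v have "\<rho> \<in> eigenvalues A"
    unfolding eigenvalues_def by (auto intro!: exI [of _ v])
  with bound show ?thesis using that by blast
qed

lemma lambda_min_rayleigh:
  fixes A :: "real^'n^'n"
  assumes "transpose A = A"
  shows "d \<bullet> (A *v d) \<ge> lambda_min A * (norm d)\<^sup>2"
proof -
  obtain \<rho> where \<rho>: "\<rho> \<in> eigenvalues A" "\<And>d. d \<bullet> (A *v d) \<ge> \<rho> * (norm d)\<^sup>2"
    using rayleigh_minimizer [OF assms] by blast
  have "lambda_min A \<le> \<rho>"
    unfolding lambda_min_def using \<rho>(1) finite_eigenvalues [OF assms] by simp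
  then have "lambda_min A * (norm d)\<^sup>2 \<le> \<rho> * (norm d)\<^sup>2"
    by (rule mult_right_mono) simp
  with \<rho>(2) [of d] show ?thesis by simp
qed

lemma lambda_min_neg:
  fixes A :: "real^'n^'n"
  assumes "transpose A = A" and "\<not> pos_semidef A"
  shows "lambda_min A < 0"
proof -
  obtain d where "d \<bullet> (A *v d) < 0"
    using assms unfolding pos_semidef_def by (auto simp: not_le)
  then have "lambda_min A * (norm d)\<^sup>2 < 0"
    using lambda_min_rayleigh [OF assms(1), of d] by simp
  then show ?thesis by (simp add: mult_less_0_iff)
qed

section \<open>Linear multipliers\<close>

text \<open>The vector \<open>w\<close> keeps \<open>0\<close> out of the convex hull of the \<open>h i\<close>, so that the cone they
  generate is closed.\<close>

lemma strict_farkas: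
  fixes h :: "'i \<Rightarrow> 'a::euclidean_space"
  assumes I: "finite I" "I \<noteq> {}"
    and w: "\<And>i. i \<in> I \<Longrightarrow> h i \<bullet> w < 0"
    and c: "\<And>e. (\<And>i. i \<in> I \<Longrightarrow> h i \<bullet> e < 0) \<Longrightarrow> c \<bullet> e \<ge> 0"
  obtains u where "\<And>i. i \<in> I \<Longrightarrow> u i \<ge> 0" and "c + (\<Sum>i\<in>I. u i *\<^sub>R h i) = 0"
proof -
  define H where "H = convex hull (h ` I)"
  \<comment> \<open>Separation is carried out with \<open>conic hull H\<close>, which is known to be
    closed; \<open>K\<close> serves to read off nonnegative coefficients, through
    \<open>H \<subseteq> K\<close>.\<close>
  define K where "K = {\<Sum>i\<in>I. u i *\<^sub>R h i | u. \<forall>i\<in>I. u i \<ge> (0::real)}"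
  have "convex {y. y \<bullet> w < 0}"
    using convex_halfspace_lt [of w 0] by (simp add: inner_commute)
  then have "H \<subseteq> {y. y \<bullet> w < 0}"
    unfolding H_def using w by (intro hull_minimal) auto
  then have "0 \<notin> H" by auto
  moreover have "compact H"
    unfolding H_def using I by (intro compact_convex_hull finite_imp_compact) simp
  ultimately have closed: "closed (conic hull H)"
    using closed_conic_hull by blast
  have convex: "convex (conic hull H)"
    unfolding H_def by (intro convex_conic_hull convex_convex_hull)
  have in_hull: "t *\<^sub>R h i \<in> conic hull H" if "i \<in> I" "t \<ge> 0" for i t
    using that hull_inc [of "h i" "h ` I" convex]
    unfolding conic_hull_explicit H_def by blast
  have zero: "0 \<in> conic hull H"
    using in_hull [of _ 0] I by auto
  have "- c \<in> conic hull H"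
  proof (rule ccontr)
    assume "- c \<notin> conic hull H"
    then obtain p q where p: "p \<bullet> (- c) < q" and q: "\<And>x. x \<in> conic hull H \<Longrightarrow> q < p \<bullet> x"
      using separating_hyperplane_closed_point [OF convex closed] by blast
    have "q < 0" using q [OF zero] by simp
    with p have pc: "p \<bullet> c > 0" by simp
    \<comment> \<open>If \<open>p \<bullet> h i\<close> were negative, the multiple of
      \<open>h i\<close> by the positive factor \<open>q / (p \<bullet> h i)\<close> would lie in
      the cone and have inner product exactly \<open>q\<close> with \<open>p\<close>, against strict
      separation.\<close>
    have ph: "p \<bullet> h i \<ge> 0" if i: "i \<in> I" for i
    proof (rule ccontr)
      assume neg: "\<not> p \<bullet> h i \<ge> 0"
      then have "q < p \<bullet> ((q / (p \<bullet> h i)) *\<^sub>R h i)"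
        using \<open>q < 0\<close> by (intro q in_hull i divide_nonpos_nonpos) auto
      with neg show False by simp
    qed
    \<comment> \<open>The direction \<open>- p\<close> satisfies only the weak inequalities. Adding
      \<open>s\<^sup>2 *\<^sub>R w\<close> to \<open>- s *\<^sub>R p\<close> makes them strict,
      while contributing only at second order in \<open>s\<close>.\<close>
    have "- (p \<bullet> c) \<ge> 0"
    proof (rule linear_term_nonneg [of 1])
      fix s :: real assume s: "0 < s" "s < 1"
      have "c \<bullet> (s\<^sup>2 *\<^sub>R w - s *\<^sub>R p) \<ge> 0"
      proof (rule c)
        fix i assume i: "i \<in> I"
        have "s\<^sup>2 * (h i \<bullet> w) < 0" using s w [OF i] by (simp add: mult_pos_neg)
        moreover have "s * (p \<bullet> h i) \<ge> 0" using s ph [OF i] by simp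
        ultimately show "h i \<bullet> (s\<^sup>2 *\<^sub>R w - s *\<^sub>R p) < 0"
          by (simp add: inner_diff_right inner_commute)
      qed
      then show "s * - (p \<bullet> c) + s\<^sup>2 * (c \<bullet> w) \<ge> 0"
        by (simp add: inner_diff_right inner_commute)
    qed simp
    with pc show False by simp
  qed
  moreover have "H \<subseteq> K"
    unfolding H_def
  proof (rule hull_minimal)
    show "h ` I \<subseteq> K"
    proof
      fix y assume "y \<in> h ` I"
      then obtain i where "i \<in> I" "y = h i" by blast
      then have "y = (\<Sum>j\<in>I. (if j = i then 1 else 0) *\<^sub>R h j)"
        using I by (simp add: if_distrib [of "\<lambda>t. t *\<^sub>R _"] cong: if_cong)
      then show "y \<in> K" unfolding K_def by force
    qed
    show "convex K"
      unfolding convex_def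
    proof (intro ballI allI impI)
      fix x y :: 'a and s t :: real
      assume "x \<in> K" "y \<in> K" and st: "0 \<le> s" "0 \<le> t" "s + t = 1"
      then obtain u v where u: "\<forall>i\<in>I. u i \<ge> 0" "x = (\<Sum>i\<in>I. u i *\<^sub>R h i)"
        and v: "\<forall>i\<in>I. v i \<ge> 0" "y = (\<Sum>i\<in>I. v i *\<^sub>R h i)"
        unfolding K_def by blast
      have "s *\<^sub>R x + t *\<^sub>R y = (\<Sum>i\<in>I. (s * u i + t * v i) *\<^sub>R h i)"
        by (simp add: u v scaleR_sum_right sum.distrib scaleR_add_left)
      then show "s *\<^sub>R x + t *\<^sub>R y \<in> K"
        unfolding K_def using u(1) v(1) st by force
    qed
  qed
  ultimately obtain t y where t: "t \<ge> 0" "y \<in> K" "- c = t *\<^sub>R y"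
    unfolding conic_hull_explicit by blast
  then obtain u where u: "\<forall>i\<in>I. u i \<ge> 0" "y = (\<Sum>i\<in>I. u i *\<^sub>R h i)"
    unfolding K_def by blast
  show ?thesis
  proof (rule that [of "\<lambda>i. t * u i"])
    show "t * u i \<ge> 0" if "i \<in> I" for i using t u that by simp
    have "c = - (t *\<^sub>R y)" using t(3) by (metis minus_minus)
    then show "c + (\<Sum>i\<in>I. (t * u i) *\<^sub>R h i) = 0"
      by (simp add: u scaleR_sum_right)
  qed
qed

section \<open>Moving feasible points to the sphere\<close>

text \<open>A dimension count: the kernel and the orthogonal complement of \<open>span B\<close>
  have dimensions adding up to more than that of the whole space, so they share a nonzero
  vector.\<close>

lemma exists_kernel_orthogonal:
  fixes M :: "real^'n^'n" and B :: "(real^'n) set"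
  assumes "dim (Ker M) \<ge> dim (span B) + 1"
  obtains d where "d \<noteq> 0" and "M *v d = 0" and "\<And>y. y \<in> B \<Longrightarrow> y \<bullet> d = 0"
proof -
  define P where "P = {y. \<forall>x\<in>span B. orthogonal x y}"
  have "subspace (Ker M)"
    unfolding Ker_def subspace_def
    by (simp add: matrix_vector_right_distrib matrix_vector_mult_scaleR)
  moreover have "subspace P"
    unfolding P_def by (rule subspace_orthogonal_to_vectors)
  ultimately have "dim {x + y |x y. x \<in> Ker M \<and> y \<in> P} + dim (Ker M \<inter> P) = dim (Ker M) + dim P"
    by (rule dim_sums_Int)
  moreover have "dim P + dim (span B) = DIM(real^'n)"
    using dim_subspace_orthogonal_to_vectors [of "span B" UNIV]
    by (simp add: P_def dim_UNIV)
  moreover have "dim {x + y |x y. x \<in> Ker M \<and> y \<in> P} \<le> DIM(real^'n)"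
    by (rule dim_subset_UNIV)
  ultimately have "dim (Ker M \<inter> P) \<noteq> 0"
    using assms by linarith
  then obtain d where "d \<in> Ker M \<inter> P" "d \<noteq> 0"
    by (auto simp: dim_eq_0)
  then show ?thesis
    using that unfolding Ker_def P_def orthogonal_def by (auto simp: span_base)
qed

text \<open>The intermediate value theorem applies to the squared distance along the ray. Since
  \<open>t\<close> is nonnegative, the caller decides through the sign of \<open>d\<close> which way
  to move.\<close>

lemma ray_meets_sphere:
  fixes x d z :: "'a::real_inner"
  assumes "d \<noteq> 0" and "(norm (x - z))\<^sup>2 \<le> \<alpha>"
  obtains t where "t \<ge> 0" and "(norm (x + t *\<^sub>R d - z))\<^sup>2 = \<alpha>"
proof -
  \<comment> \<open>A displacement by twice the radius takes every point of the ball to distance at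
    least one radius from the center.\<close>
  define T where "T = 2 * sqrt \<alpha> / norm d"
  have \<alpha>: "\<alpha> \<ge> 0" using assms(2) zero_le_power2 order_trans by blast
  have "norm (x - z) \<le> sqrt \<alpha>" using assms(2) by (rule real_le_rsqrt)
  moreover have "norm (T *\<^sub>R d) = 2 * sqrt \<alpha>" using assms \<alpha> by (simp add: T_def)
  moreover have "norm (T *\<^sub>R d) - norm (x - z) \<le> norm (x + T *\<^sub>R d - z)"
    using norm_diff_ineq [of "T *\<^sub>R d" "x - z"] by (simp add: algebra_simps)
  ultimately have "sqrt \<alpha> \<le> norm (x + T *\<^sub>R d - z)" by linarith
  then have "\<alpha> \<le> (norm (x + T *\<^sub>R d - z))\<^sup>2" by (rule sqrt_le_D)
  moreover have "0 \<le> T" using \<alpha> by (simp add: T_def)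
  moreover have "continuous_on {0..T} (\<lambda>t. (norm (x + t *\<^sub>R d - z))\<^sup>2)"
    by (intro continuous_intros)
  ultimately obtain t where "0 \<le> t" "(norm (x + t *\<^sub>R d - z))\<^sup>2 = \<alpha>"
    using IVT' [of "\<lambda>t. (norm (x + t *\<^sub>R d - z))\<^sup>2" 0 \<alpha> T] assms(2) by auto
  then show ?thesis by (rule that)
qed

section \<open>Necessity and sufficiency of the multiplier conditions\<close>

theorem theorem4p1:
  fixes A :: "real^'n^'n"
    and a x0 :: "real^'n"
    and m :: nat
    and b :: "nat \<Rightarrow> real^'n"
    and \<alpha> :: real
    and \<beta> :: "nat \<Rightarrow> real"
    and xstar :: "real^'n"
  assumes A_sym: "transpose A = A"
    and A_not_psd: "\<not> pos_semidef A"
    and alpha_pos: "\<alpha> > 0"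
    and slater: "\<exists>xbar. (norm (xbar - x0))\<^sup>2 < \<alpha> \<and> (\<forall>i\<in>{1..m}. b i \<bullet> xbar < \<beta> i)"
    and dim_cond: "dim (Ker (A - lambda_min A *\<^sub>R mat 1)) \<ge> dim (span (b ` {1..m})) + 1"
    and xstar_feasible: "feasible m x0 \<alpha> b \<beta> xstar"
  shows "is_arg_min (objective A a) (feasible m x0 \<alpha> b \<beta>) xstar \<longleftrightarrow>
    (\<exists>lam :: nat \<Rightarrow> real.
      (\<forall>i\<in>{0..m}. lam i \<ge> 0) \<and>
      2 *\<^sub>R (A *v xstar) + a + (2 * lam 0) *\<^sub>R (xstar - x0)
        + (\<Sum>i=1..m. lam i *\<^sub>R b i) = 0 \<and>
      lam 0 * ((norm (xstar - x0))\<^sup>2 - \<alpha>) = 0 \<and>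
      (\<forall>i\<in>{1..m}. lam i * (b i \<bullet> xstar - \<beta> i) = 0) \<and>
      pos_semidef (A + lam 0 *\<^sub>R mat 1))"
proof -
  define \<mu> where "\<mu> = lambda_min A"
  define G where "G x = objective A a x - \<mu> * ((norm (x - x0))\<^sup>2 - \<alpha>)" for x
  \<comment> \<open>The coefficient of \<open>t\<^sup>2\<close> is nonnegative by the Rayleigh bound
    and vanishes when \<open>e\<close> is an eigenvector for \<mu>.\<close>
  have G_add: "G (x + t *\<^sub>R e) = G x
      + t * ((2 *\<^sub>R (A *v x) + a - (2 * \<mu>) *\<^sub>R (x - x0)) \<bullet> e)
      + t\<^sup>2 * (e \<bullet> (A *v e) - \<mu> * (norm e)\<^sup>2)" for x t e
    unfolding G_def objective_add_scaleR [OF A_sym] norm_add_scaleR_power2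
    by (simp add: inner_diff_left inner_add_left algebra_simps)
  have mu_neg: "\<mu> < 0"
    unfolding \<mu>_def using A_sym A_not_psd by (rule lambda_min_neg)
  have G_le: "G x \<le> objective A a x" if "feasible m x0 \<alpha> b \<beta> x" for x
    using that mu_neg unfolding G_def feasible_def by (simp add: mult_nonpos_nonpos)
  obtain d where d: "d \<noteq> 0" "A *v d = \<mu> *\<^sub>R d" "\<And>i. i \<in> {1..m} \<Longrightarrow> b i \<bullet> d = 0"
  proof -
    obtain d where "d \<noteq> 0" "(A - \<mu> *\<^sub>R mat 1) *v d = 0" "\<And>y. y \<in> b ` {1..m} \<Longrightarrow> y \<bullet> d = 0"
      using exists_kernel_orthogonal [OF dim_cond] unfolding \<mu>_def by blast
    then show ?thesis using that by (simp add: matrix_shift_mult_vec)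
  qed
  have to_sphere: "\<exists>y. feasible m x0 \<alpha> b \<beta> y \<and> objective A a y \<le> G x"
    if x: "feasible m x0 \<alpha> b \<beta> x" for x
  proof -
    define c where "c = 2 *\<^sub>R (A *v x) + a - (2 * \<mu>) *\<^sub>R (x - x0)"
    \<comment> \<open>Both signs of \<open>d\<close> are eigenvectors orthogonal to the
      \<open>b i\<close>; the one chosen does not increase the linear term of
      \<open>G\<close>.\<close>
    define e where "e = (if c \<bullet> d \<le> 0 then d else - d)"
    have e: "e \<noteq> 0" "A *v e = \<mu> *\<^sub>R e" "\<And>i. i \<in> {1..m} \<Longrightarrow> b i \<bullet> e = 0" "c \<bullet> e \<le> 0"
      using d matrix_vector_mult_scaleR [of A "-1" d] by (auto simp: e_def)
    obtain t where t: "t \<ge> 0" "(norm (x + t *\<^sub>R e - x0))\<^sup>2 = \<alpha>"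
      using ray_meets_sphere [OF e(1)] x unfolding feasible_def by blast
    have "feasible m x0 \<alpha> b \<beta> (x + t *\<^sub>R e)"
      using x t e(3) unfolding feasible_def by (simp add: inner_add_right)
    moreover have "objective A a (x + t *\<^sub>R e) = G (x + t *\<^sub>R e)"
      by (simp add: G_def t)
    moreover have "G (x + t *\<^sub>R e) = G x + t * (c \<bullet> e)"
      unfolding G_add c_def by (simp add: e(2) power2_norm_eq_inner)
    moreover have "t * (c \<bullet> e) \<le> 0"
      using t(1) e(4) by (rule mult_nonneg_nonpos)
    ultimately show ?thesis by fastforce
  qed
  show ?thesis
  proof
    assume "is_arg_min (objective A a) (feasible m x0 \<alpha> b \<beta>) xstar"
    then have min: "objective A a xstar \<le> objective A a y" if "feasible m x0 \<alpha> b \<beta> y" for y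
      using that unfolding is_arg_min_def by (auto simp: not_less)
    have min_G: "objective A a xstar \<le> G x" if "feasible m x0 \<alpha> b \<beta> x" for x
      using to_sphere [OF that] min by fastforce
    \<comment> \<open>Both bounds are taken at \<open>xstar\<close> itself. Since \<mu> is nonzero,
      equality forces the ball constraint to be active.\<close>
    have eq: "G xstar = objective A a xstar"
      using min_G G_le xstar_feasible by (intro order_antisym) auto
    then have sphere: "(norm (xstar - x0))\<^sup>2 = \<alpha>"
      using mu_neg by (simp add: G_def)
    define c where "c = 2 *\<^sub>R (A *v xstar) + a - (2 * \<mu>) *\<^sub>R (xstar - x0)"
    \<comment> \<open>These are the constraint gradients at \<open>xstar\<close>, with index 0 for
      the ball as in the numbering of the multipliers. The set \<open>I\<close> collects the active
      constraints and always contains 0.\<close>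
    define h where "h i = (if i = 0 then 2 *\<^sub>R (xstar - x0) else b i)" for i :: nat
    define I where "I = insert 0 {i \<in> {1..m}. b i \<bullet> xstar = \<beta> i}"
    obtain xbar where xbar: "(norm (xbar - x0))\<^sup>2 < \<alpha>" "\<And>i. i \<in> {1..m} \<Longrightarrow> b i \<bullet> xbar < \<beta> i"
      using slater by blast
    \<comment> \<open>The direction towards the Slater point plays the role of \<open>w\<close> in
      \<open>strict_farkas\<close>.\<close>
    have "h i \<bullet> (xbar - xstar) < 0" if "i \<in> I" for i
    proof (cases "i = 0")
      case True
      have "(norm (xbar - x0))\<^sup>2
          = \<alpha> + 2 * ((xstar - x0) \<bullet> (xbar - xstar)) + (norm (xbar - xstar))\<^sup>2"
        using norm_add_scaleR_power2 [of xstar 1 "xbar - xstar" x0] sphere by simp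
      moreover have "(norm (xbar - xstar))\<^sup>2 \<ge> 0" by simp
      ultimately have "2 * ((xstar - x0) \<bullet> (xbar - xstar)) < 0" using xbar(1) by linarith
      then show ?thesis using True by (simp add: h_def)
    next
      case False
      then show ?thesis
        using that xbar(2) [of i] by (simp add: h_def I_def inner_diff_right)
    qed
    \<comment> \<open>A direction strictly decreasing all active constraints to first order stays
      feasible for short steps, the inactive ones holding by continuity. There \<open>G\<close>
      cannot fall below \<open>G xstar\<close>, and \<open>c\<close> is its gradient at
      \<open>xstar\<close>.\<close>
    moreover have "c \<bullet> e \<ge> 0" if e: "\<And>i. i \<in> I \<Longrightarrow> h i \<bullet> e < 0" for e
    proof -
      have "eventually (\<lambda>t. (norm (xstar + t *\<^sub>R e - x0))\<^sup>2 \<le> \<alpha>) (at_right 0)"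
      proof -
        \<comment> \<open>This expression is the change of the squared distance to \<open>x0\<close>
          divided by \<open>t\<close>.\<close>
        have "((\<lambda>t. h 0 \<bullet> e + t * (norm e)\<^sup>2) \<longlongrightarrow> h 0 \<bullet> e + 0 * (norm e)\<^sup>2) (at_right 0)"
          by (intro tendsto_intros)
        moreover have "h 0 \<bullet> e + 0 * (norm e)\<^sup>2 < 0" using e by (simp add: I_def)
        ultimately have "eventually (\<lambda>t. h 0 \<bullet> e + t * (norm e)\<^sup>2 < 0) (at_right 0)"
          by (rule order_tendstoD)
        then show ?thesis
          using eventually_at_right_less
        proof eventually_elim
          case (elim t)
          then have "t * (h 0 \<bullet> e + t * (norm e)\<^sup>2) \<le> 0"
            by (intro mult_nonneg_nonpos) auto
          then show ?case
            unfolding norm_add_scaleR_power2 sphere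
            by (simp add: h_def power2_eq_square algebra_simps)
        qed
      qed
      moreover have "eventually (\<lambda>t. \<forall>i\<in>{1..m}. b i \<bullet> (xstar + t *\<^sub>R e) \<le> \<beta> i) (at_right 0)"
      proof (intro eventually_ball_finite ballI)
        fix i assume i: "i \<in> {1..m}"
        show "eventually (\<lambda>t. b i \<bullet> (xstar + t *\<^sub>R e) \<le> \<beta> i) (at_right 0)"
        proof (cases "i \<in> I")
          case True
          with i e [OF True] have bi: "b i \<bullet> xstar = \<beta> i" "b i \<bullet> e < 0"
            by (auto simp: I_def h_def)
          show ?thesis
            using eventually_at_right_less
          proof eventually_elim
            case (elim t)
            then show ?case
              using bi by (simp add: inner_add_right mult_nonneg_nonpos)
          qed
        next
          case False
          have "((\<lambda>t. b i \<bullet> (xstar + t *\<^sub>R e)) \<longlongrightarrow> b i \<bullet> (xstar + 0 *\<^sub>R e)) (at_right 0)"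
            by (intro tendsto_intros)
          moreover have "b i \<bullet> (xstar + 0 *\<^sub>R e) < \<beta> i"
          proof -
            have "b i \<bullet> xstar \<le> \<beta> i"
              using xstar_feasible i unfolding feasible_def by blast
            moreover have "b i \<bullet> xstar \<noteq> \<beta> i"
              using False i unfolding I_def by blast
            ultimately show ?thesis by simp
          qed
          ultimately have "eventually (\<lambda>t. b i \<bullet> (xstar + t *\<^sub>R e) < \<beta> i) (at_right 0)"
            by (rule order_tendstoD)
          then show ?thesis by eventually_elim simp
        qed
      qed simp
      ultimately have "eventually (\<lambda>t. feasible m x0 \<alpha> b \<beta> (xstar + t *\<^sub>R e)) (at_right 0)"
        unfolding feasible_def by (rule eventually_conj)
      then obtain \<delta> where \<delta>: "\<delta> > 0"
        "\<And>t. 0 < t \<Longrightarrow> t < \<delta> \<Longrightarrow> feasible m x0 \<alpha> b \<beta> (xstar + t *\<^sub>R e)"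
        unfolding eventually_at_right_field by auto
      show ?thesis
      proof (rule linear_term_nonneg [OF \<delta>(1)])
        fix t assume "0 < t" "t < \<delta>"
        then have "G xstar \<le> G (xstar + t *\<^sub>R e)"
          using min_G \<delta>(2) eq by simp
        then show "t * (c \<bullet> e) + t\<^sup>2 * (e \<bullet> (A *v e) - \<mu> * (norm e)\<^sup>2) \<ge> 0"
          unfolding G_add c_def by simp
      qed
    qed
    moreover have "finite I" "I \<noteq> {}" by (auto simp: I_def)
    ultimately obtain u where u: "\<And>i. i \<in> I \<Longrightarrow> u i \<ge> 0" "c + (\<Sum>i\<in>I. u i *\<^sub>R h i) = 0"
      using strict_farkas [of I h "xbar - xstar" c] by blast
    \<comment> \<open>The shift by \<open>- \<mu>\<close> turns \<open>c\<close> back into the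
      gradient of the objective and makes \<open>lam 0\<close> at least \<open>- \<mu>\<close>,
      which yields semidefiniteness. The default 0 gives complementarity for inactive
      constraints.\<close>
    define lam where "lam i = (if i = 0 then u 0 - \<mu> else if i \<in> I then u i else 0)" for i
    have u0: "u 0 \<ge> 0" using u by (simp add: I_def)
    have "(\<Sum>i\<in>I. u i *\<^sub>R h i)
        = (2 * u 0) *\<^sub>R (xstar - x0) + (\<Sum>i | i \<in> {1..m} \<and> b i \<bullet> xstar = \<beta> i. u i *\<^sub>R h i)"
      unfolding I_def by (subst sum.insert) (auto simp: h_def)
    also have "(\<Sum>i | i \<in> {1..m} \<and> b i \<bullet> xstar = \<beta> i. u i *\<^sub>R h i) = (\<Sum>i=1..m. lam i *\<^sub>R b i)"
      by (rule sum.mono_neutral_cong_left) (auto simp: lam_def h_def I_def)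
    finally have sum_I: "(\<Sum>i\<in>I. u i *\<^sub>R h i)
        = (2 * u 0) *\<^sub>R (xstar - x0) + (\<Sum>i=1..m. lam i *\<^sub>R b i)" .
    have "(2 * lam 0) *\<^sub>R (xstar - x0)
        = (2 * u 0) *\<^sub>R (xstar - x0) - (2 * \<mu>) *\<^sub>R (xstar - x0)"
      by (simp add: lam_def scaleR_diff_left [symmetric])
    then have "2 *\<^sub>R (A *v xstar) + a + (2 * lam 0) *\<^sub>R (xstar - x0)
        + (\<Sum>i=1..m. lam i *\<^sub>R b i) = c + (\<Sum>i\<in>I. u i *\<^sub>R h i)"
      unfolding sum_I c_def by (simp only: diff_conv_add_uminus add_ac)
    then have "2 *\<^sub>R (A *v xstar) + a + (2 * lam 0) *\<^sub>R (xstar - x0)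
        + (\<Sum>i=1..m. lam i *\<^sub>R b i) = 0"
      using u(2) by (rule trans)
    moreover have "\<forall>i\<in>{0..m}. lam i \<ge> 0"
      using u u0 mu_neg by (auto simp: lam_def)
    moreover have "lam 0 * ((norm (xstar - x0))\<^sup>2 - \<alpha>) = 0"
      by (simp add: sphere)
    moreover have "\<forall>i\<in>{1..m}. lam i * (b i \<bullet> xstar - \<beta> i) = 0"
      by (auto simp: lam_def I_def)
    moreover have "pos_semidef (A + lam 0 *\<^sub>R mat 1)"
      unfolding pos_semidef_def
    proof (intro conjI allI)
      have "A $ j $ i = A $ i $ j" for i j
        using A_sym by (metis transpose_def vec_lambda_beta)
      then show "transpose (A + lam 0 *\<^sub>R mat 1) = A + lam 0 *\<^sub>R mat 1"
        by (auto simp: transpose_def mat_def vec_eq_iff)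
      fix e
      have "e \<bullet> ((A + lam 0 *\<^sub>R mat 1) *v e)
          = (e \<bullet> (A *v e) - \<mu> * (norm e)\<^sup>2) + u 0 * (norm e)\<^sup>2"
        unfolding matrix_shift_mult_vec
        by (simp add: power2_norm_eq_inner lam_def algebra_simps)
      then show "e \<bullet> ((A + lam 0 *\<^sub>R mat 1) *v e) \<ge> 0"
        using lambda_min_rayleigh [OF A_sym, of e] u0 by (simp add: \<mu>_def)
    qed
    ultimately show "\<exists>lam. (\<forall>i\<in>{0..m}. lam i \<ge> 0) \<and>
      2 *\<^sub>R (A *v xstar) + a + (2 * lam 0) *\<^sub>R (xstar - x0)
        + (\<Sum>i=1..m. lam i *\<^sub>R b i) = 0 \<and>
      lam 0 * ((norm (xstar - x0))\<^sup>2 - \<alpha>) = 0 \<and>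
      (\<forall>i\<in>{1..m}. lam i * (b i \<bullet> xstar - \<beta> i) = 0) \<and>
      pos_semidef (A + lam 0 *\<^sub>R mat 1)"
      by blast
  next
    assume "\<exists>lam. (\<forall>i\<in>{0..m}. lam i \<ge> 0) \<and>
      2 *\<^sub>R (A *v xstar) + a + (2 * lam 0) *\<^sub>R (xstar - x0)
        + (\<Sum>i=1..m. lam i *\<^sub>R b i) = 0 \<and>
      lam 0 * ((norm (xstar - x0))\<^sup>2 - \<alpha>) = 0 \<and>
      (\<forall>i\<in>{1..m}. lam i * (b i \<bullet> xstar - \<beta> i) = 0) \<and>
      pos_semidef (A + lam 0 *\<^sub>R mat 1)"
    then obtain lam where nonneg: "\<And>i. i \<in> {0..m} \<Longrightarrow> lam i \<ge> 0"
      and stat: "2 *\<^sub>R (A *v xstar) + a + (2 * lam 0) *\<^sub>R (xstar - x0)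
        + (\<Sum>i=1..m. lam i *\<^sub>R b i) = 0"
      and comp0: "lam 0 * ((norm (xstar - x0))\<^sup>2 - \<alpha>) = 0"
      and comp: "\<And>i. i \<in> {1..m} \<Longrightarrow> lam i * (b i \<bullet> xstar - \<beta> i) = 0"
      and psd: "pos_semidef (A + lam 0 *\<^sub>R mat 1)"
      by blast
    have "objective A a xstar \<le> objective A a y" if y: "feasible m x0 \<alpha> b \<beta> y" for y
    proof -
      define e where "e = y - xstar"
      \<comment> \<open>The explicit factor 1 lets the expansions along a line apply at
        \<open>t = 1\<close>.\<close>
      have y_eq: "y = xstar + 1 *\<^sub>R e" by (simp add: e_def)
      have "lam 0 * ((norm (y - x0))\<^sup>2 - \<alpha>) \<le> 0"
        using y nonneg [of 0] unfolding feasible_def by (intro mult_nonneg_nonpos) auto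
      then have ball: "2 * lam 0 * ((xstar - x0) \<bullet> e) + lam 0 * (norm e)\<^sup>2 \<le> 0"
        using comp0 unfolding y_eq norm_add_scaleR_power2 by (auto simp: algebra_simps)
      have lin: "(\<Sum>i=1..m. lam i *\<^sub>R b i) \<bullet> e \<le> 0"
        unfolding inner_sum_left
      proof (rule sum_nonpos)
        fix i assume i: "i \<in> {1..m}"
        have "lam i * (b i \<bullet> y - \<beta> i) \<le> 0"
          using y nonneg [of i] i unfolding feasible_def by (intro mult_nonneg_nonpos) auto
        then show "(lam i *\<^sub>R b i) \<bullet> e \<le> 0"
          using comp [OF i] by (auto simp: e_def algebra_simps)
      qed
      have "0 \<le> e \<bullet> ((A + lam 0 *\<^sub>R mat 1) *v e)"
        using psd by (simp add: pos_semidef_def)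
      then have curv: "0 \<le> e \<bullet> (A *v e) + lam 0 * (norm e)\<^sup>2"
        by (simp add: matrix_shift_mult_vec inner_add_right power2_norm_eq_inner)
      \<comment> \<open>Stationarity with \<open>ball\<close> and \<open>lin\<close> bounds the
        linear term of the objective below by \<open>lam 0 * (norm e)\<^sup>2\<close>, exactly what
        \<open>curv\<close> needs to offset a negative \<open>e \<bullet> (A *v e)\<close>.\<close>
      have "(2 *\<^sub>R (A *v xstar) + a) \<bullet> e + 2 * lam 0 * ((xstar - x0) \<bullet> e)
          + (\<Sum>i=1..m. lam i *\<^sub>R b i) \<bullet> e = 0"
        using arg_cong [OF stat, of "\<lambda>v. v \<bullet> e"] by (simp add: inner_add_left)
      moreover have "objective A a y = objective A a xstar
          + (2 *\<^sub>R (A *v xstar) + a) \<bullet> e + e \<bullet> (A *v e)"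
        unfolding y_eq objective_add_scaleR [OF A_sym] by simp
      ultimately show ?thesis using ball lin curv by linarith
    qed
    then show "is_arg_min (objective A a) (feasible m x0 \<alpha> b \<beta>) xstar"
      using xstar_feasible unfolding is_arg_min_def by (auto simp: not_less)
  qed
qed

end
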